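(* Let $\mu:\mathbb{N} \to \mathbb{R}^+$ be a scaling function. Then the following statements are equivalent. (i) The equality $\mathbf{P}(E) = \mathbf{P}_{\mu}(M)$ holds for every $E \subseteq \mathbb{R}^+$ with $M= M_{E, \mu}$. (ii) The scaling function $\mu$ satisfies the limit relation $\displaystyle\lim_{n \to \infty} \frac{\mu(n+1)}{\mu(n)}=1$.
   Context: $\mathbb{R}^+=[0,\infty)$. A scaling function is a strictly decreasing function $\mu:\mathbb{N}\to\mathbb{R}^+$ with $\lim_{n\to\infty}\mu(n)=0$; here $\mathbb{N}=\{1,2,\dots\}$. For $X\subseteq\mathbb{R}^+$ and $h>0$, $\lambda(X,h)$ is the length of the largest open subinterval of $(0,h)$ that contains no point of $X$ (it is $0$ if there is no such nonempty interval). $\mathbf{P}(X)$ is the set of porosity numbers of $X$ at $0$, i.e. of all real $p$ such that $p=\lim_{k\to\infty}\lambda(X,h_k)/h_k$ for some sequence of $h_k>0$ with $\lim_{k\to\infty}h_k=0$. For $A\subseteq\mathbb{N}$ and $n\in\mathbb{N}$, $$\lambda_\mu(A,n)=\sup\{|\mu(n^{(1)})-\mu(n^{(2)})| : n\le n^{(1)}<n^{(2)},\ n^{(1)},n^{(2)}\in\mathbb{N},\ (n^{(1)},n^{(2)})\cap A=\emptyset\}.$$ $\mathbf{P}_\mu(A)$ is the set of all $p$ such that $p=\lim_{k\to\infty}\lambda_\mu(A,n_k)/\mu(n_k)$ for some strictly increasing sequence $(n_k)$ of natural numbers. For $E\subseteq\mathbb{R}^+$ let $\overline E$ be the closure of $E$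 in $\mathbb{R}^+$. The set $M_{E,\mu}\subseteq\mathbb{N}$ is defined as follows: an integer $m\ge2$ belongs to $M_{E,\mu}$ if and only if $[\mu(m+1),\mu(m-1)]\cap\overline E\ne\emptyset$; the number $1$ belongs to $M_{E,\mu}$ if and only if $[\mu(2),\infty)\cap\overline E\neq\emptyset$. *)

theory Defs
  imports "HOL-Analysis.Analysis"
begin

text \<open>The index set \<open>{1,2,\<dots>}\<close> is \<open>{1..} :: nat set\<close>: a scaling function is a function
  on \<^typ>\<open>nat\<close> whose value at \<open>0\<close> is irrelevant. The half-line is \<open>{0..} :: real set\<close>.\<close>

definition scaling_function :: "(nat \<Rightarrow> real) \<Rightarrow> bool" where
  "scaling_function \<mu> \<longleftrightarrow>
     \<mu> \<in> {1..} \<rightarrow> {0..} \<and> strict_antimono_on {1..} \<mu> \<and> \<mu> \<longlonglongrightarrow> 0"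

text \<open>The supremum below is attained; the inserted \<open>0\<close> covers the case that no nonempty
  open subinterval of \<open>(0,h)\<close> avoids \<open>X\<close>.\<close>

definition gap_length :: "real set \<Rightarrow> real \<Rightarrow> real" where
  "gap_length X h =
     Sup (insert 0 {b - a | a b. a < b \<and> {a<..<b} \<subseteq> {0<..<h} \<and> {a<..<b} \<inter> X = {}})"

definition porosity_numbers :: "real set \<Rightarrow> real set" where
  "porosity_numbers X =
     {p. \<exists>h :: nat \<Rightarrow> real. (\<forall>k. 0 < h k) \<and> h \<longlonglongrightarrow> 0 \<and>
           (\<lambda>k. gap_length X (h k) / h k) \<longlonglongrightarrow> p}"

definition scaled_gap_length :: "(nat \<Rightarrow> real) \<Rightarrow> nat set \<Rightarrow> nat \<Rightarrow> real" where
  "scaled_gap_length \<mu> A n =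
     Sup {\<bar>\<mu> n1 - \<mu> n2\<bar> | n1 n2. 1 \<le> n1 \<and> n \<le> n1 \<and> n1 < n2 \<and> {n1<..<n2} \<inter> A = {}}"

definition scaled_porosity_numbers :: "(nat \<Rightarrow> real) \<Rightarrow> nat set \<Rightarrow> real set" where
  "scaled_porosity_numbers \<mu> A =
     {p. \<exists>r :: nat \<Rightarrow> nat. (\<forall>k. 1 \<le> r k) \<and> strict_mono r \<and>
           (\<lambda>k. scaled_gap_length \<mu> A (r k) / \<mu> (r k)) \<longlonglongrightarrow> p}"

text \<open>For \<open>E \<subseteq> {0..}\<close> the closure in the half-line is the closure in the real line,
  the half-line being closed.\<close>

definition M_set :: "real set \<Rightarrow> (nat \<Rightarrow> real) \<Rightarrow> nat set" where
  "M_set E \<mu> =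
     {m. 2 \<le> m \<and> {\<mu> (m + 1)..\<mu> (m - 1)} \<inter> closure E \<noteq> {} \<or>
         m = 1 \<and> {\<mu> 2..} \<inter> closure E \<noteq> {}}"

end

theory Submission
  imports Defs
begin

text \<open>If the ratios tend to \<open>1\<close>, the points \<open>\<mu> m\<close> with \<open>m \<ge> n\<close> form an
  \<open>o(\<mu> n)\<close>-net of \<open>(0, \<mu> n)\<close>, so that gaps of \<open>E\<close> below \<open>\<mu> n\<close> and gaps of \<open>M_set E \<mu>\<close>
  beyond \<open>n\<close> correspond to each other up to an error \<open>o(\<mu> n)\<close>; as \<open>gap_length E\<close> is
  1-Lipschitz, a general \<open>h\<close> may be replaced by a neighbouring value of \<open>\<mu>\<close>. Conversely, the
  half-line \<open>E = {0..}\<close> has \<open>0\<close> as its only porosity number, whereas the scaled gap length of any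
  set at \<open>n\<close> is at least \<open>\<mu> n - \<mu> (n + 1)\<close>; hence (i) forces \<open>1 - \<mu> (n + 1) / \<mu> n\<close> to tend
  to \<open>0\<close>.\<close>

section \<open>Order and positivity of scaling functions\<close>

lemma scaling_function_less:
  assumes "scaling_function \<mu>" "1 \<le> m" "m < n"
  shows "\<mu> n < \<mu> m"
  using assms unfolding scaling_function_def monotone_on_def by auto

lemma scaling_function_le:
  assumes "scaling_function \<mu>" "1 \<le> m" "m \<le> n"
  shows "\<mu> n \<le> \<mu> m"
  using scaling_function_less[OF assms(1,2), of n] assms(3) by (cases "m = n") auto

text \<open>The codomain only gives a weak inequality; it becomes strict because a further, smaller
  value is still nonnegative.\<close>

lemma scaling_function_pos:
  assumes "scaling_function \<mu>" "1 \<le> n"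
  shows "0 < \<mu> n"
proof -
  have "0 \<le> \<mu> (Suc n)"
    using assms unfolding scaling_function_def by auto
  also have "\<dots> < \<mu> n"
    using scaling_function_less[OF assms, of "Suc n"] by simp
  finally show ?thesis .
qed

lemma scaling_function_index_less:
  assumes "scaling_function \<mu>" "1 \<le> n" "\<mu> n < \<mu> m"
  shows "m < n"
  using scaling_function_le[OF assms(1,2), of m] assms(3) by force

section \<open>Gap lengths of sets of reals\<close>

lemma greaterThanLessThan_subset_iff_real:
  fixes a b h :: real
  assumes "a < b"
  shows "{a<..<b} \<subseteq> {0<..<h} \<longleftrightarrow> 0 \<le> a \<and> b \<le> h"
  using assms greaterThanLessThan_subseteq_greaterThanLessThan by force

lemma gap_length_upper:
  assumes "0 \<le> a" "a < b" "b \<le> h" "{a<..<b} \<inter> X = {}"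
  shows "b - a \<le> gap_length X h"
  unfolding gap_length_def
proof (rule cSup_upper)
  show "b - a \<in> insert 0 {b - a |a b. a < b \<and> {a<..<b} \<subseteq> {0<..<h} \<and> {a<..<b} \<inter> X = {}}"
    using assms greaterThanLessThan_subset_iff_real[of a b h] by blast
  show "bdd_above (insert 0 {b - a |a b. a < b \<and> {a<..<b} \<subseteq> {0<..<h} \<and> {a<..<b} \<inter> X = {}})"
    by (rule bdd_aboveI[of _ "max 0 h"]) (auto simp: greaterThanLessThan_subset_iff_real)
qed

lemma gap_length_least:
  assumes "0 \<le> c"
    and "\<And>a b. 0 \<le> a \<Longrightarrow> a < b \<Longrightarrow> b \<le> h \<Longrightarrow> {a<..<b} \<inter> X = {} \<Longrightarrow> b - a \<le> c"
  shows "gap_length X h \<le> c"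
  unfolding gap_length_def
  by (rule cSup_least) (use assms in \<open>auto simp: greaterThanLessThan_subset_iff_real\<close>)

lemma gap_length_nonneg: "0 \<le> gap_length X h"
  unfolding gap_length_def
  by (intro cSup_upper bdd_aboveI[of _ "max 0 h"])
    (auto simp: greaterThanLessThan_subset_iff_real)

lemma gap_length_le_self: "0 \<le> h \<Longrightarrow> gap_length X h \<le> h"
  by (rule gap_length_least) auto

lemma gap_length_mono: "h \<le> h' \<Longrightarrow> gap_length X h \<le> gap_length X h'"
  by (rule gap_length_least) (auto intro!: gap_length_upper gap_length_nonneg)

text \<open>Cutting a gap below \<open>h'\<close> off at \<open>h\<close> loses at most
  \<open>h' - h\<close>; a gap with nothing left after the cut lies above \<open>h\<close> and is
  itself no longer than \<open>h' - h\<close>. With monotonicity this is the 1-Lipschitz property in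
  \<open>h\<close>.\<close>

lemma gap_length_diff_le:
  assumes "h \<le> h'"
  shows "gap_length X h' \<le> gap_length X h + (h' - h)"
proof (rule gap_length_least)
  show "0 \<le> gap_length X h + (h' - h)"
    using assms gap_length_nonneg[of X h] by simp
next
  fix a b :: real
  assume ab: "0 \<le> a" "a < b" "b \<le> h'" "{a<..<b} \<inter> X = {}"
  show "b - a \<le> gap_length X h + (h' - h)"
  proof (cases "a < min b h")
    case True
    have "min b h - a \<le> gap_length X h"
      using True ab by (intro gap_length_upper) auto
    then show ?thesis using ab assms by (auto simp: min_def split: if_splits)
  next
    case False
    then show ?thesis using ab assms gap_length_nonneg[of X h] by auto
  qed
qed

text \<open>The test set for the converse direction: the midpoint of any candidate gap lies in the
  half-line, so every gap length is \<open>0\<close>.\<close>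

lemma porosity_numbers_half_line: "porosity_numbers {0..} \<subseteq> {0}"
proof -
  have "gap_length {0..} h = 0" for h
  proof (rule antisym[OF gap_length_least gap_length_nonneg])
    fix a b :: real
    assume "0 \<le> a" "a < b" "{a<..<b} \<inter> {0..} = {}"
    moreover have "(a + b) / 2 \<in> {a<..<b} \<inter> {0..}"
      using \<open>0 \<le> a\<close> \<open>a < b\<close> by auto
    ultimately show "b - a \<le> 0" by blast
  qed simp
  then show ?thesis
    by (auto simp: porosity_numbers_def LIMSEQ_const_iff)
qed

section \<open>Scaled gap lengths of index sets\<close>

lemma scaled_gap_length_upper:
  assumes \<mu>: "scaling_function \<mu>"
    and "1 \<le> n1" "n \<le> n1" "n1 < n2" "{n1<..<n2} \<inter> A = {}"
  shows "\<mu> n1 - \<mu> n2 \<le> scaled_gap_length \<mu> A n"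
proof -
  have "\<bar>\<mu> n1 - \<mu> n2\<bar> \<le> scaled_gap_length \<mu> A n"
    unfolding scaled_gap_length_def
  proof (rule cSup_upper)
    show "bdd_above {\<bar>\<mu> n1 - \<mu> n2\<bar> |n1 n2. 1 \<le> n1 \<and> n \<le> n1 \<and> n1 < n2 \<and> {n1<..<n2} \<inter> A = {}}"
    proof (rule bdd_aboveI[of _ "\<mu> 1"], clarify)
      fix i j :: nat
      assume "1 \<le> i" "i < j"
      then show "\<bar>\<mu> i - \<mu> j\<bar> \<le> \<mu> 1"
        using scaling_function_less[OF \<mu>, of i j] scaling_function_le[OF \<mu>, of 1 i]
          scaling_function_pos[OF \<mu>, of j] by auto
    qed
  qed (use assms in blast)
  then show ?thesis by simp
qed

lemma scaled_gap_length_least: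
  assumes \<mu>: "scaling_function \<mu>"
    and le: "\<And>i j. 1 \<le> i \<Longrightarrow> n \<le> i \<Longrightarrow> i < j \<Longrightarrow> {i<..<j} \<inter> A = {} \<Longrightarrow> \<mu> i - \<mu> j \<le> c"
  shows "scaled_gap_length \<mu> A n \<le> c"
  unfolding scaled_gap_length_def
proof (rule cSup_least)
  \<comment> \<open>Consecutive indices enclose nothing, so the set under the supremum is nonempty.
    Starting at \<open>Suc n\<close> keeps the first index at least \<open>1\<close> even for
    \<open>n = 0\<close>.\<close>
  have "{Suc n<..<Suc (Suc n)} \<inter> A = {}" by auto
  then have "\<bar>\<mu> (Suc n) - \<mu> (Suc (Suc n))\<bar> \<in>
      {\<bar>\<mu> n1 - \<mu> n2\<bar> |n1 n2. 1 \<le> n1 \<and> n \<le> n1 \<and> n1 < n2 \<and> {n1<..<n2} \<inter> A = {}}"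
    by fastforce
  then show "{\<bar>\<mu> n1 - \<mu> n2\<bar> |n1 n2. 1 \<le> n1 \<and> n \<le> n1 \<and> n1 < n2 \<and> {n1<..<n2} \<inter> A = {}} \<noteq> {}"
    by blast
next
  fix x
  assume "x \<in> {\<bar>\<mu> n1 - \<mu> n2\<bar> |n1 n2. 1 \<le> n1 \<and> n \<le> n1 \<and> n1 < n2 \<and> {n1<..<n2} \<inter> A = {}}"
  then obtain i j where ij: "x = \<bar>\<mu> i - \<mu> j\<bar>" "1 \<le> i" "n \<le> i" "i < j" "{i<..<j} \<inter> A = {}"
    by blast
  then show "x \<le> c"
    using le[of i j] scaling_function_less[OF \<mu>, of i j] by auto
qed

section \<open>Gaps of \<open>E\<close> against gaps of \<open>M_set E \<mu>\<close>\<close>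

lemma exists_scaling_value_between:
  assumes lim: "\<mu> \<longlonglongrightarrow> (0::real)"
    and step: "\<And>m. n \<le> m \<Longrightarrow> \<mu> m - \<mu> (Suc m) \<le> d"
    and "x < \<mu> n" "x + d < y" "0 < y"
  obtains m where "n \<le> m" "x < \<mu> m" "\<mu> m < y"
proof -
  have "eventually (\<lambda>m. \<mu> m < y) sequentially"
    using order_tendstoD(2)[OF lim \<open>0 < y\<close>] .
  then obtain N where "\<And>m. N \<le> m \<Longrightarrow> \<mu> m < y"
    unfolding eventually_at_top_linorder by blast
  then have ex: "\<exists>m. n \<le> m \<and> \<mu> m < y"
    by (intro exI[of _ "max n N"]) simp
  \<comment> \<open>A discrete intermediate value argument: at the first index with value below
    \<open>y\<close>, the drop from the preceding value, still at least \<open>y\<close>, is at most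
    \<open>d < y - x\<close>, so the sequence cannot jump over the interval from \<open>x\<close> to
    \<open>y\<close>. If that index is \<open>n\<close> itself, \<open>x < \<mu> n\<close> is
    given.\<close>
  define m where "m = (LEAST m. n \<le> m \<and> \<mu> m < y)"
  have m: "n \<le> m" "\<mu> m < y"
    using LeastI_ex[OF ex] unfolding m_def by auto
  have "x < \<mu> m"
  proof (cases "m = n")
    case False
    then obtain k where k: "m = Suc k" "n \<le> k"
      using m(1) by (cases m) auto
    then have "\<not> \<mu> k < y"
      using not_less_Least[of k "\<lambda>m. n \<le> m \<and> \<mu> m < y"] unfolding m_def[symmetric] by auto
    then show ?thesis using step[OF k(2)] k(1) assms(4) by auto
  qed (use assms(3) in simp)
  then show thesis using m that by blast
qed

text \<open>A gap from \<open>a\<close> to \<open>b\<close> is approximated from inside by values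
  \<open>\<mu> j\<close> near \<open>a\<close> and \<open>\<mu> i\<close> near \<open>b\<close>,
  each end costing at most \<open>c\<close>. The strict bound \<open>d < c\<close> lets steps of
  size up to \<open>d\<close> hit every interval of length \<open>c\<close> involved.\<close>

lemma gap_length_le_scaled_gap_length:
  assumes \<mu>: "scaling_function \<mu>" and n: "1 \<le> n"
    and step: "\<And>m. n \<le> m \<Longrightarrow> \<mu> m - \<mu> (Suc m) \<le> d" and "d < c"
  shows "gap_length E (\<mu> n) \<le> scaled_gap_length \<mu> (M_set E \<mu>) n + 2 * c"
proof (rule gap_length_least)
  have d: "0 < d"
    using step[of n] scaling_function_less[OF \<mu> n, of "Suc n"] by simp
  have "\<mu> n - \<mu> (Suc n) \<le> scaled_gap_length \<mu> (M_set E \<mu>) n"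
    using n by (intro scaled_gap_length_upper[OF \<mu>]) auto
  then have nonneg: "0 \<le> scaled_gap_length \<mu> (M_set E \<mu>) n"
    using scaling_function_less[OF \<mu> n, of "Suc n"] by simp
  then show "0 \<le> scaled_gap_length \<mu> (M_set E \<mu>) n + 2 * c"
    using d \<open>d < c\<close> by simp
  fix a b :: real
  assume ab: "0 \<le> a" "a < b" "b \<le> \<mu> n" "{a<..<b} \<inter> E = {}"
  show "b - a \<le> scaled_gap_length \<mu> (M_set E \<mu>) n + 2 * c"
  \<comment> \<open>A short gap is absorbed by the error term. For a long one,
    \<open>a + c < b - c\<close> forces \<open>\<mu> j < \<mu> i\<close>, hence
    \<open>i < j\<close>.\<close>
  proof (cases "b - a \<le> 2 * c")
    case True
    then show ?thesis using nonneg by simp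
  next
    case False
    have lim: "\<mu> \<longlonglongrightarrow> 0" using \<mu> unfolding scaling_function_def by blast
    obtain j where j: "n \<le> j" "a < \<mu> j" "\<mu> j < a + c"
      by (rule exists_scaling_value_between[OF lim step, of n a "a + c"])
        (use ab d \<open>d < c\<close> in auto)
    obtain i where i: "n \<le> i" "b - c < \<mu> i" "\<mu> i < b"
      by (rule exists_scaling_value_between[OF lim step, of n "b - c" b])
        (use ab d \<open>d < c\<close> in auto)
    have "i < j"
      using scaling_function_index_less[OF \<mu>, of j i] i j n False by auto
    have "{a<..<b} \<inter> closure E = {}"
      using ab(4) open_Int_closure_eq_empty[of "{a<..<b}" E] by simp
    \<comment> \<open>The window of an index strictly between \<open>i\<close> and \<open>j\<close>
      stays between \<open>\<mu> j\<close> and \<open>\<mu> i\<close>, so it misses the closure of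
      \<open>E\<close>. Such an index is at least \<open>2\<close>, which excludes the special
      clause for \<open>1\<close> in \<open>M_set\<close>.\<close>
    moreover have "{\<mu> (m + 1)..\<mu> (m - 1)} \<subseteq> {a<..<b}" if "i < m" "m < j" for m
    proof -
      have "\<mu> j \<le> \<mu> (m + 1)" "\<mu> (m - 1) \<le> \<mu> i"
        using that i(1) n by (auto intro!: scaling_function_le[OF \<mu>])
      then show ?thesis using i j by auto
    qed
    ultimately have "{i<..<j} \<inter> M_set E \<mu> = {}"
      using i(1) n unfolding M_set_def by fastforce
    then have "\<mu> i - \<mu> j \<le> scaled_gap_length \<mu> (M_set E \<mu>) n"
      using i(1) n \<open>i < j\<close> by (intro scaled_gap_length_upper[OF \<mu>]) auto
    then show ?thesis using i j by simp
  qed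
qed

text \<open>A point of \<open>E\<close> between \<open>\<mu> j\<close> and \<open>\<mu> i\<close>
  lies in the windows of two neighbouring indices, and unless \<open>j = Suc i\<close> at least one
  of them is strictly between \<open>i\<close> and \<open>j\<close>. Adjacent \<open>i\<close> and
  \<open>j\<close> say nothing about \<open>E\<close>; they account for the error
  \<open>d\<close>.\<close>

lemma scaled_gap_length_le_gap_length:
  assumes \<mu>: "scaling_function \<mu>" and n: "1 \<le> n"
    and step: "\<And>m. n \<le> m \<Longrightarrow> \<mu> m - \<mu> (Suc m) \<le> d"
  shows "scaled_gap_length \<mu> (M_set E \<mu>) n \<le> gap_length E (\<mu> n) + d"
proof (rule scaled_gap_length_least[OF \<mu>])
  fix i j :: nat
  assume ij: "1 \<le> i" "n \<le> i" "i < j" "{i<..<j} \<inter> M_set E \<mu> = {}"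
  have d: "0 < d"
    using step[of n] scaling_function_less[OF \<mu> n, of "Suc n"] by simp
  show "\<mu> i - \<mu> j \<le> gap_length E (\<mu> n) + d"
  proof (cases "j = Suc i")
    case True
    then show ?thesis using step[OF ij(2)] gap_length_nonneg[of E "\<mu> n"] by simp
  next
    case False
    have "x \<notin> E" if x: "\<mu> j < x" "x < \<mu> i" for x
    proof
      assume "x \<in> E"
      then have xE: "x \<in> closure E" using closure_subset by blast
      \<comment> \<open>This brackets \<open>x\<close> by consecutive values,
        \<open>\<mu> k \<le> x < \<mu> (k - 1)\<close>, with \<open>i < k \<le> j\<close>.\<close>
      define k where "k = (LEAST k. \<mu> k \<le> x \<and> i < k)"
      have k: "\<mu> k \<le> x" "i < k"
        using LeastI[of "\<lambda>k. \<mu> k \<le> x \<and> i < k" j] x ij unfolding k_def by auto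
      have kj: "k \<le> j"
        using Least_le[of "\<lambda>k. \<mu> k \<le> x \<and> i < k" j] x ij unfolding k_def by auto
      have k1: "x < \<mu> (k - 1)"
      proof (cases "k = Suc i")
        case False
        then show ?thesis
          using k not_less_Least[of "k - 1" "\<lambda>k. \<mu> k \<le> x \<and> i < k"]
          unfolding k_def[symmetric] by auto
      qed (use x in simp)
      show False
      \<comment> \<open>If \<open>k < j\<close>, then \<open>k\<close> is the forbidden member of
        \<open>M_set E \<mu>\<close>. If \<open>k = j\<close>, it is \<open>k - 1\<close>, which
        still exceeds \<open>i\<close> because \<open>j\<close> is not \<open>Suc i\<close>, and is
        at least \<open>2\<close> because \<open>i\<close> is at least \<open>1\<close>.\<close>
      proof (cases "k = j")
        case False
        have "\<mu> (k + 1) \<le> \<mu> k" using k(2) by (intro scaling_function_le[OF \<mu>]) auto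
        then have "x \<in> {\<mu> (k + 1)..\<mu> (k - 1)}" using k k1 by auto
        then have "k \<in> M_set E \<mu>" using xE k ij(1) unfolding M_set_def by auto
        moreover have "k \<in> {i<..<j}" using k kj False by simp
        ultimately show False using ij(4) by blast
      next
        case True
        have "\<mu> (k - 1) \<le> \<mu> (k - 1 - 1)"
          using True \<open>j \<noteq> Suc i\<close> ij by (intro scaling_function_le[OF \<mu>]) auto
        moreover have "k - 1 + 1 = k" using k by simp
        ultimately have "x \<in> {\<mu> (k - 1 + 1)..\<mu> (k - 1 - 1)}" using k k1 by auto
        moreover have "2 \<le> k - 1" using True \<open>j \<noteq> Suc i\<close> ij by simp
        ultimately have "k - 1 \<in> M_set E \<mu>" using xE unfolding M_set_def by blast
        moreover have "k - 1 \<in> {i<..<j}" using True \<open>j \<noteq> Suc i\<close> ij(3) by auto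
        ultimately show False using ij(4) by blast
      qed
    qed
    then have "{\<mu> j<..<\<mu> i} \<inter> E = {}" by auto
    then have "\<mu> i - \<mu> j \<le> gap_length E (\<mu> n)"
      using scaling_function_less[OF \<mu> ij(1,3)] scaling_function_le[OF \<mu> n ij(2)]
        scaling_function_pos[OF \<mu>, of j] ij
      by (intro gap_length_upper) auto
    then show ?thesis using d by simp
  qed
qed

section \<open>Normalised gap lengths at and near the scaling values\<close>

lemma gap_lengths_asymptotically_equal:
  assumes \<mu>: "scaling_function \<mu>" and ratio: "(\<lambda>n. \<mu> (n + 1) / \<mu> n) \<longlonglongrightarrow> 1"
  shows "(\<lambda>n. scaled_gap_length \<mu> (M_set E \<mu>) n / \<mu> n - gap_length E (\<mu> n) / \<mu> n) \<longlonglongrightarrow> 0"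
proof (rule LIMSEQ_I)
  fix e :: real
  assume "0 < e"
  \<comment> \<open>With \<open>e / 8\<close> the two comparisons apply with
    \<open>d = e / 8 * \<mu> n\<close> and the strictly larger \<open>c = e / 4 * \<mu> n\<close>.
    Their errors, \<open>e / 2\<close> and \<open>e / 8\<close> times \<open>\<mu> n\<close>, are
    both below \<open>e * \<mu> n\<close>.\<close>
  then have "eventually (\<lambda>n. 1 - e / 8 < \<mu> (n + 1) / \<mu> n) sequentially"
    using order_tendstoD(1)[OF ratio, of "1 - e / 8"] by simp
  then obtain N where N: "\<And>n. N \<le> n \<Longrightarrow> 1 - e / 8 < \<mu> (n + 1) / \<mu> n"
    unfolding eventually_at_top_linorder by blast
  have "norm (scaled_gap_length \<mu> (M_set E \<mu>) n / \<mu> n - gap_length E (\<mu> n) / \<mu> n - 0) < e"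
    if "max 1 N \<le> n" for n
  proof -
    have n: "1 \<le> n" "N \<le> n" using that by auto
    have pos: "0 < \<mu> n" using scaling_function_pos[OF \<mu> n(1)] .
    have step: "\<mu> m - \<mu> (Suc m) \<le> e / 8 * \<mu> n" if "n \<le> m" for m
    proof -
      have "0 < \<mu> m" using scaling_function_pos[OF \<mu>, of m] n that by simp
      then have "\<mu> m - \<mu> (Suc m) \<le> e / 8 * \<mu> m"
        using N[of m] n that by (simp add: field_simps)
      also have "\<dots> \<le> e / 8 * \<mu> n"
        using scaling_function_le[OF \<mu> n(1) that] \<open>0 < e\<close> by (intro mult_left_mono) auto
      finally show ?thesis .
    qed
    have "gap_length E (\<mu> n) \<le> scaled_gap_length \<mu> (M_set E \<mu>) n + 2 * (e / 4 * \<mu> n)"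
      using pos \<open>0 < e\<close>
      by (intro gap_length_le_scaled_gap_length[where d = "e / 8 * \<mu> n"] \<mu> n(1) step) auto
    moreover have "scaled_gap_length \<mu> (M_set E \<mu>) n \<le> gap_length E (\<mu> n) + e / 8 * \<mu> n"
      by (intro scaled_gap_length_le_gap_length \<mu> n(1) step)
    moreover have "0 < e * \<mu> n" using pos \<open>0 < e\<close> by simp
    ultimately have "\<bar>scaled_gap_length \<mu> (M_set E \<mu>) n - gap_length E (\<mu> n)\<bar> < e * \<mu> n"
      by (simp add: abs_less_iff)
    then show ?thesis
      using pos by (simp add: diff_divide_distrib[symmetric] abs_divide pos_divide_less_eq)
  qed
  then show "\<exists>N. \<forall>n\<ge>N. norm (scaled_gap_length \<mu> (M_set E \<mu>) n / \<mu> n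
      - gap_length E (\<mu> n) / \<mu> n - 0) < e"
    by blast
qed

text \<open>This moves \<open>h\<close> to a neighbouring scaling value: the quotient changes little
  once \<open>h' / h\<close> is close to \<open>1\<close>. One direction is the Lipschitz bound; the
  other uses monotonicity and that a gap below \<open>h\<close> is no longer than
  \<open>h\<close>.\<close>

lemma gap_length_quotient_diff_le:
  assumes "0 < h" "h \<le> h'"
  shows "\<bar>gap_length X h' / h' - gap_length X h / h\<bar> \<le> h' / h - 1"
proof -
  let ?g = "gap_length X h" and ?g' = "gap_length X h'"
  have pos: "0 < h'" using assms by simp
  have "?g' / h' \<le> ?g' / h"
    using assms gap_length_nonneg by (intro divide_left_mono) auto
  also have "\<dots> \<le> (?g + (h' - h)) / h"
    using assms gap_length_diff_le[OF assms(2)] by (intro divide_right_mono) auto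
  also have "\<dots> = ?g / h + (h' / h - 1)"
    using assms by (simp add: field_simps)
  finally have upper: "?g' / h' - ?g / h \<le> h' / h - 1" by simp
  have "?g / h - ?g' / h' \<le> ?g / h - ?g / h'"
    using pos gap_length_mono[OF assms(2), of X] by (simp add: divide_right_mono)
  also have "\<dots> = ?g * (h' - h) / (h * h')"
    using assms pos by (simp add: field_simps)
  also have "\<dots> \<le> h' * (h' - h) / (h * h')"
    using assms pos gap_length_le_self[of h X]
    by (intro divide_right_mono mult_right_mono) auto
  also have "\<dots> = h' / h - 1"
    using assms pos by (simp add: field_simps)
  finally show ?thesis using upper by (simp add: abs_le_iff)
qed

section \<open>Equality of the porosity sets under the ratio condition\<close>

lemma strict_mono_subseq_of_filterlim:
  fixes f :: "nat \<Rightarrow> nat"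
  assumes "filterlim f at_top sequentially"
  obtains s :: "nat \<Rightarrow> nat" where "strict_mono s" "strict_mono (f \<circ> s)"
proof -
  have "\<exists>k'>k. f k < f k'" for k
  proof -
    have "eventually (\<lambda>k'. Suc (f k) \<le> f k') sequentially"
      using assms by (simp only: filterlim_at_top)
    then have "eventually (\<lambda>k'. f k < f k' \<and> k < k') sequentially"
      using eventually_gt_at_top[of k] by eventually_elim auto
    then show ?thesis by (auto simp: eventually_at_top_linorder)
  qed
  then obtain t where t: "\<And>k. k < t k" "\<And>k. f k < f (t k)" by metis
  \<comment> \<open>Each application of \<open>t\<close> increases both the index and its image
    under \<open>f\<close>, so iterating it makes \<open>s\<close> and \<open>f \<circ> s\<close>
    strictly increasing together.\<close>
  define s where "s k = (t ^^ k) 0" for k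
  have "strict_mono s" "strict_mono (f \<circ> s)"
    by (auto simp: strict_mono_Suc_iff s_def t)
  then show thesis using that by blast
qed

lemma exists_scaling_index_le:
  assumes \<mu>: "scaling_function \<mu>" and "0 < h"
  obtains n where "1 \<le> n" "\<mu> n \<le> h" "n = 1 \<or> h < \<mu> (n - 1)"
proof -
  have lim: "\<mu> \<longlonglongrightarrow> 0" using \<mu> unfolding scaling_function_def by blast
  then have "eventually (\<lambda>n. \<mu> n < h) sequentially"
    using order_tendstoD(2)[OF _ \<open>0 < h\<close>] by blast
  then obtain N where "\<And>n. N \<le> n \<Longrightarrow> \<mu> n < h"
    unfolding eventually_at_top_linorder by blast
  then have ex: "1 \<le> max 1 N \<and> \<mu> (max 1 N) \<le> h"
    by (simp add: less_imp_le)
  define n where "n = (LEAST n. 1 \<le> n \<and> \<mu> n \<le> h)"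
  have n: "1 \<le> n" "\<mu> n \<le> h"
    using LeastI[of "\<lambda>n. 1 \<le> n \<and> \<mu> n \<le> h", OF ex] unfolding n_def by auto
  moreover have "n = 1 \<or> h < \<mu> (n - 1)"
    using n not_less_Least[of "n - 1" "\<lambda>n. 1 \<le> n \<and> \<mu> n \<le> h"]
    unfolding n_def[symmetric] by auto
  ultimately show thesis using that by blast
qed

lemma scaled_porosity_numbers_subset:
  assumes \<mu>: "scaling_function \<mu>" and ratio: "(\<lambda>n. \<mu> (n + 1) / \<mu> n) \<longlonglongrightarrow> 1"
  shows "scaled_porosity_numbers \<mu> (M_set E \<mu>) \<subseteq> porosity_numbers E"
proof
  fix p
  assume "p \<in> scaled_porosity_numbers \<mu> (M_set E \<mu>)"
  then obtain r where r: "\<And>k. 1 \<le> r k" "strict_mono r"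
    and p: "(\<lambda>k. scaled_gap_length \<mu> (M_set E \<mu>) (r k) / \<mu> (r k)) \<longlonglongrightarrow> p"
    unfolding scaled_porosity_numbers_def by blast
  have "\<mu> \<longlonglongrightarrow> 0" using \<mu> unfolding scaling_function_def by blast
  then have "(\<lambda>k. \<mu> (r k)) \<longlonglongrightarrow> 0"
    using LIMSEQ_subseq_LIMSEQ[OF _ r(2)] by (fastforce simp: o_def)
  moreover have "\<forall>k. 0 < \<mu> (r k)"
    using scaling_function_pos[OF \<mu> r(1)] by blast
  moreover have "(\<lambda>k. gap_length E (\<mu> (r k)) / \<mu> (r k)) \<longlonglongrightarrow> p"
    using tendsto_diff[OF p LIMSEQ_subseq_LIMSEQ[OF gap_lengths_asymptotically_equal[OF \<mu> ratio, of E] r(2)]]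
    by (simp add: o_def)
  ultimately show "p \<in> porosity_numbers E"
    unfolding porosity_numbers_def by (intro CollectI exI[of _ "\<lambda>k. \<mu> (r k)"]) auto
qed

text \<open>Each \<open>h k\<close> is rounded down to a scaling value \<open>\<mu> (f k)\<close>.
  The rounding factor is at most \<open>\<mu> (f k - 1) / \<mu> (f k)\<close>, which tends to
  \<open>1\<close>, so the limit \<open>p\<close> survives and then passes to the scaled gap
  lengths.\<close>

lemma porosity_numbers_subset:
  assumes \<mu>: "scaling_function \<mu>" and ratio: "(\<lambda>n. \<mu> (n + 1) / \<mu> n) \<longlonglongrightarrow> 1"
  shows "porosity_numbers E \<subseteq> scaled_porosity_numbers \<mu> (M_set E \<mu>)"
proof
  fix p
  assume "p \<in> porosity_numbers E"
  then obtain h where h: "\<And>k. 0 < h k" "h \<longlonglongrightarrow> 0" and p: "(\<lambda>k. gap_length E (h k) / h k) \<longlonglongrightarrow> p"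
    unfolding porosity_numbers_def by blast
  have "\<forall>k. \<exists>n\<ge>1. \<mu> n \<le> h k \<and> (n = 1 \<or> h k < \<mu> (n - 1))"
    using exists_scaling_index_le[OF \<mu> h(1)] by metis
  then obtain f where f: "\<And>k. 1 \<le> f k" "\<And>k. \<mu> (f k) \<le> h k" "\<And>k. f k = 1 \<or> h k < \<mu> (f k - 1)"
    by metis
  have f_top: "filterlim f at_top sequentially"
    unfolding filterlim_at_top
  proof
    fix N :: nat
    have "eventually (\<lambda>k. h k < \<mu> (max 1 N)) sequentially"
      using order_tendstoD(2)[OF h(2) scaling_function_pos[OF \<mu>]] by simp
    then show "eventually (\<lambda>k. N \<le> f k) sequentially"
    proof eventually_elim
      case (elim k)
      then show ?case
        using scaling_function_index_less[OF \<mu> f(1), of k "max 1 N"] f(2)[of k] by simp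
    qed
  qed
  have f1: "filterlim (\<lambda>k. f k - 1) at_top sequentially"
    using filterlim_compose[OF filterlim_minus_const_nat_at_top f_top] .
  have "(\<lambda>n. inverse (\<mu> (n + 1) / \<mu> n)) \<longlonglongrightarrow> inverse 1"
    by (intro tendsto_inverse ratio) simp
  then have "(\<lambda>k. \<mu> (f k - 1) / \<mu> (f k - 1 + 1)) \<longlonglongrightarrow> 1"
    using filterlim_compose[OF _ f1] by fastforce
  moreover have "f k - 1 + 1 = f k" for k using f(1)[of k] by simp
  ultimately have "(\<lambda>k. \<mu> (f k - 1) / \<mu> (f k)) \<longlonglongrightarrow> 1"
    by (simp only:)
  then have quot: "(\<lambda>k. \<mu> (f k - 1) / \<mu> (f k) - 1) \<longlonglongrightarrow> 0"
    using tendsto_diff[of _ 1 sequentially "\<lambda>_. 1" 1] by fastforce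
  \<comment> \<open>For \<open>f k = 1\<close> there is no upper bound on \<open>h k\<close>; beyond
    that, \<open>h k < \<mu> (f k - 1)\<close>.\<close>
  have "eventually (\<lambda>k. 1 < f k) sequentially"
    using f_top by (simp only: filterlim_at_top less_eq_Suc_le)
  then have "eventually (\<lambda>k. norm (gap_length E (h k) / h k - gap_length E (\<mu> (f k)) / \<mu> (f k))
      \<le> \<mu> (f k - 1) / \<mu> (f k) - 1) sequentially"
  proof eventually_elim
    case (elim k)
    have pos: "0 < \<mu> (f k)" using scaling_function_pos[OF \<mu> f(1)] .
    have "h k / \<mu> (f k) \<le> \<mu> (f k - 1) / \<mu> (f k)"
      using elim f(3)[of k] pos by (intro divide_right_mono) auto
    then show ?case
      using gap_length_quotient_diff_le[OF pos f(2), of E] by simp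
  qed
  then have "(\<lambda>k. gap_length E (h k) / h k - gap_length E (\<mu> (f k)) / \<mu> (f k)) \<longlonglongrightarrow> 0"
    by (rule Lim_null_comparison[OF _ quot])
  from tendsto_diff[OF p this]
  have "(\<lambda>k. gap_length E (\<mu> (f k)) / \<mu> (f k)) \<longlonglongrightarrow> p" by simp
  from tendsto_add[OF this filterlim_compose[OF gap_lengths_asymptotically_equal[OF \<mu> ratio, of E] f_top]]
  have lim: "(\<lambda>k. scaled_gap_length \<mu> (M_set E \<mu>) (f k) / \<mu> (f k)) \<longlonglongrightarrow> p" by simp
  \<comment> \<open>The indices \<open>f k\<close> tend to infinity but may repeat or decrease,
    whereas scaled porosity numbers require strictly increasing indices.\<close>
  obtain s :: "nat \<Rightarrow> nat" where s: "strict_mono s" "strict_mono (f \<circ> s)"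
    using strict_mono_subseq_of_filterlim[OF f_top] .
  show "p \<in> scaled_porosity_numbers \<mu> (M_set E \<mu>)"
    unfolding scaled_porosity_numbers_def
    using s(2) f(1) LIMSEQ_subseq_LIMSEQ[OF lim s(1)]
    by (intro CollectI exI[of _ "f \<circ> s"]) (auto simp: o_def)
qed

section \<open>Necessity of the ratio condition\<close>

lemma ratio_tendsto_one:
  assumes \<mu>: "scaling_function \<mu>" and zero: "scaled_porosity_numbers \<mu> A \<subseteq> {0}"
  shows "(\<lambda>n. \<mu> (n + 1) / \<mu> n) \<longlonglongrightarrow> 1"
proof (rule ccontr)
  assume not: "\<not> ?thesis"
  \<comment> \<open>The ratios stay below \<open>1\<close>, so convergence to \<open>1\<close> can
    only fail from below.\<close>
  have "\<exists>e>0. \<exists>\<^sub>F n in sequentially. \<mu> (n + 1) / \<mu> n \<le> 1 - e"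
  proof (rule ccontr)
    assume "\<not> ?thesis"
    then have ev: "eventually (\<lambda>n. 1 - e < \<mu> (n + 1) / \<mu> n) sequentially" if "0 < e" for e
      using that by (auto simp: frequently_def not_le)
    have "(\<lambda>n. \<mu> (n + 1) / \<mu> n) \<longlonglongrightarrow> 1"
    proof (rule order_tendstoI)
      fix a :: real assume "a < 1"
      then show "eventually (\<lambda>n. a < \<mu> (n + 1) / \<mu> n) sequentially"
        using ev[of "1 - a"] by simp
    next
      fix a :: real assume "1 < a"
      show "eventually (\<lambda>n. \<mu> (n + 1) / \<mu> n < a) sequentially"
        using eventually_ge_at_top[of 1]
      proof eventually_elim
        case (elim n)
        have "\<mu> (n + 1) / \<mu> n < 1"
          using scaling_function_pos[OF \<mu> elim] scaling_function_less[OF \<mu> elim, of "n + 1"] by simp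
        then show ?case using \<open>1 < a\<close> by simp
      qed
    qed
    then show False using not by blast
  qed
  then obtain e where e: "0 < e" and freq: "\<exists>\<^sub>F n in sequentially. \<mu> (n + 1) / \<mu> n \<le> 1 - e"
    by blast
  define S where "S = {n. 1 \<le> n \<and> \<mu> (n + 1) / \<mu> n \<le> 1 - e}"
  have "\<exists>\<^sub>F n in sequentially. n \<in> S"
    unfolding S_def using frequently_eventually_frequently[OF freq eventually_ge_at_top[of 1]]
    by (auto elim: frequently_elim1)
  then have inf: "infinite S"
    using frequently_cofinite[of "\<lambda>n. n \<in> S"] by (simp add: cofinite_eq_sequentially)
  define r where "r = enumerate S"
  have r: "strict_mono r" "\<And>k. r k \<in> S"
    using inf unfolding r_def by (auto simp: strict_mono_enumerate enumerate_in_set)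
  define g where "g k = scaled_gap_length \<mu> A (r k) / \<mu> (r k)" for k
  have g: "e \<le> g k" "g k \<le> 1" for k
  proof -
    have rk: "1 \<le> r k" "\<mu> (r k + 1) / \<mu> (r k) \<le> 1 - e" using r(2)[of k] unfolding S_def by auto
    have pos: "0 < \<mu> (r k)" using scaling_function_pos[OF \<mu> rk(1)] .
    \<comment> \<open>No index lies strictly between neighbours, so this pair is admissible whatever
      \<open>A\<close> is.\<close>
    have "\<mu> (r k) - \<mu> (r k + 1) \<le> scaled_gap_length \<mu> A (r k)"
      using rk(1) by (intro scaled_gap_length_upper[OF \<mu>]) auto
    then have "e * \<mu> (r k) \<le> scaled_gap_length \<mu> A (r k)"
      using rk(2) pos by (simp add: pos_divide_le_eq left_diff_distrib)
    then show "e \<le> g k" using pos unfolding g_def by (simp add: pos_le_divide_eq)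
    have "\<mu> i - \<mu> j \<le> \<mu> (r k)" if "r k \<le> i" "i < j" for i j
      using scaling_function_le[OF \<mu> rk(1) that(1)] scaling_function_pos[OF \<mu>, of j] that by auto
    then have "scaled_gap_length \<mu> A (r k) \<le> \<mu> (r k)"
      by (intro scaled_gap_length_least[OF \<mu>]) auto
    then show "g k \<le> 1" using pos unfolding g_def by simp
  qed
  \<comment> \<open>Compactness yields a convergent subsequence; its limit is a scaled porosity
    number of at least \<open>e > 0\<close>, a contradiction.\<close>
  have "compact {e..1}" "\<forall>k. g k \<in> {e..1}" using g by auto
  then obtain p s where p: "p \<in> {e..1}" and s: "strict_mono s" "(g \<circ> s) \<longlonglongrightarrow> p"
    unfolding compact_def by blast
  have "p \<in> scaled_porosity_numbers \<mu> A"
    unfolding scaled_porosity_numbers_def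
    using s r strict_mono_o[OF r(1) s(1)]
    by (intro CollectI exI[of _ "r \<circ> s"]) (auto simp: o_def g_def S_def)
  then show False using zero p e by auto
qed

theorem theorem4p22:
  fixes \<mu> :: "nat \<Rightarrow> real"
  assumes "scaling_function \<mu>"
  shows "(\<forall>E\<subseteq>{0..}. porosity_numbers E = scaled_porosity_numbers \<mu> (M_set E \<mu>))
         \<longleftrightarrow> (\<lambda>n. \<mu> (n + 1) / \<mu> n) \<longlonglongrightarrow> 1"
proof
  assume "\<forall>E\<subseteq>{0..}. porosity_numbers E = scaled_porosity_numbers \<mu> (M_set E \<mu>)"
  then have "scaled_porosity_numbers \<mu> (M_set {0..} \<mu>) \<subseteq> {0}"
    using porosity_numbers_half_line by blast
  then show "(\<lambda>n. \<mu> (n + 1) / \<mu> n) \<longlonglongrightarrow> 1"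
    by (rule ratio_tendsto_one[OF assms])
next
  assume "(\<lambda>n. \<mu> (n + 1) / \<mu> n) \<longlonglongrightarrow> 1"
  then show "\<forall>E\<subseteq>{0..}. porosity_numbers E = scaled_porosity_numbers \<mu> (M_set E \<mu>)"
    using porosity_numbers_subset[OF assms] scaled_porosity_numbers_subset[OF assms] by blast
qed

end
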